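(* Let $\mathcal{H}$ be a complex Hilbert space, let $A,B\in\mathcal{B}(\mathcal{H})$ and let $X\in\mathcal{B}(\mathcal{H})$ be a positive operator. Then for every $\lambda\in\mathbb{C}$ and all $x,y\in\mathcal{H}$, $$|\langle AXBx,y\rangle|\le \|X\|\Big[\max\{|\lambda|,|1-\lambda|\}\,\|Bx\|\,\|A^*y\|+|\lambda|\,|\langle ABx,y\rangle|\Big].$$ In particular, for all $x,y\in\mathcal{H}$, $$|\langle AXBx,y\rangle|\le \frac{\|X\|}{2}\big(|\langle ABx,y\rangle|+\|Bx\|\,\|A^*y\|\big).$$
   Context: $\mathcal{B}(\mathcal{H})$ denotes the algebra of bounded linear operators on $\mathcal{H}$ and $\|\cdot\|$ denotes the vector norm or the operator norm. An operator $X$ is positive if $X=X^*$ and $\langle Xx,x\rangle\ge 0$ for all $x\in\mathcal{H}$. *)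

theory Defs
  imports "HOL-Analysis.Analysis"
begin

text \<open>
  A complex inner product space carries the real inner product \<open>Re \<langle>x, y\<rangle>\<close>; basing the class on
  \<^class>\<open>real_inner\<close> in this way makes its norm, metric and topology the ones induced by \<open>cinner\<close>
  (see \<open>cinner_self\<close>).  \<open>cinner\<close> is linear in its first argument.
\<close>

class complex_inner = real_inner +
  fixes scaleC :: "complex \<Rightarrow> 'a \<Rightarrow> 'a"  (infixr "*\<^sub>C" 75)
    and cinner :: "'a \<Rightarrow> 'a \<Rightarrow> complex"
  assumes scaleC_add_right: "c *\<^sub>C (x + y) = c *\<^sub>C x + c *\<^sub>C y"
    and scaleC_add_left: "(c + d) *\<^sub>C x = c *\<^sub>C x + d *\<^sub>C x"
    and scaleC_scaleC: "c *\<^sub>C d *\<^sub>C x = (c * d) *\<^sub>C x"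
    and scaleC_of_real: "complex_of_real r *\<^sub>C x = r *\<^sub>R x"
    and cinner_commute: "cinner x y = cnj (cinner y x)"
    and cinner_add_left: "cinner (x + y) z = cinner x z + cinner y z"
    and cinner_scaleC_left: "cinner (c *\<^sub>C x) y = c * cinner x y"
    and inner_eq_Re_cinner: "inner x y = Re (cinner x y)"

class chilbert_space = complex_inner + complete_space

instantiation complex :: chilbert_space
begin

definition scaleC_complex :: "complex \<Rightarrow> complex \<Rightarrow> complex"
  where "scaleC_complex c x = c * x"

definition cinner_complex :: "complex \<Rightarrow> complex \<Rightarrow> complex"
  where "cinner_complex x y = x * cnj y"

instance
  by standard
    (simp_all add: scaleC_complex_def cinner_complex_def algebra_simps scaleR_conv_of_real
      inner_complex_def)

end

lemma cinner_self: "cinner x x = complex_of_real ((norm x)\<^sup>2)"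
  for x :: "'a::complex_inner"
proof (rule complex_eqI)
  show "Re (cinner x x) = Re (complex_of_real ((norm x)\<^sup>2))"
    by (simp add: power2_norm_eq_inner inner_eq_Re_cinner)
  show "Im (cinner x x) = Im (complex_of_real ((norm x)\<^sup>2))"
    using arg_cong[OF cinner_commute[of x x], of Im] by simp
qed

definition bounded_clinear :: "('a::complex_inner \<Rightarrow> 'a) \<Rightarrow> bool"
  where "bounded_clinear A \<longleftrightarrow> bounded_linear A \<and> (\<forall>c x. A (c *\<^sub>C x) = c *\<^sub>C A x)"

definition cadjoint :: "('a::complex_inner \<Rightarrow> 'a) \<Rightarrow> 'a \<Rightarrow> 'a"
  where "cadjoint A = (THE A'. \<forall>x y. cinner (A x) y = cinner x (A' y))"

definition positive_op :: "('a::complex_inner \<Rightarrow> 'a) \<Rightarrow> bool"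
  where "positive_op X \<longleftrightarrow> X = cadjoint X \<and> (\<forall>x. cinner (X x) x \<in> \<real>\<^sub>\<ge>\<^sub>0)"

text \<open>On a Hilbert space, the description in \<open>cadjoint\<close> is met by exactly one map.\<close>

lemma riesz_real:
  fixes g :: "'a::{real_inner,complete_space} \<Rightarrow> real"
  assumes "bounded_linear g"
  shows "\<exists>z. \<forall>x. g x = inner x z"
proof -
  interpret g: bounded_linear g by fact
  define Q where "Q x = inner x x / 2 - g x" for x
  obtain K where K: "\<And>x. norm (g x) \<le> norm x * K" using g.bounded by blast
  have low: "Q x \<ge> - K\<^sup>2 / 2" for x
  proof -
    have "g x \<le> norm x * K" using K[of x] by simp
    moreover have "0 \<le> (norm x - K)\<^sup>2" by simp
    ultimately show ?thesis
      unfolding Q_def by (simp add: power2_norm_eq_inner[symmetric] power2_diff)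
  qed
  define m where "m = Inf (range Q)"
  have bdd: "bdd_below (range Q)" using low by (intro bdd_belowI) auto
  have m: "m \<le> Q x" for x unfolding m_def using bdd by (intro cInf_lower) auto
  have "\<exists>x. Q x < m + 1 / real (Suc n)" for n
  proof -
    have "Inf (range Q) < m + 1 / real (Suc n)" unfolding m_def by simp
    then show ?thesis using cInf_less_iff[OF _ bdd] by auto
  qed
  then obtain u where u: "\<And>n. Q (u n) < m + 1 / real (Suc n)" by metis
  have par: "(norm (x - y))\<^sup>2 = 4 * (Q x + Q y - 2 * Q ((1/2) *\<^sub>R (x + y)))" for x y
    unfolding Q_def
    by (simp add: power2_norm_eq_inner g.scaleR g.add inner_add_left inner_add_right
        inner_diff_left inner_diff_right inner_commute field_simps)
  have close: "(norm (u i - u j))\<^sup>2 < 8 / real (Suc N)" if "i \<ge> N" "j \<ge> N" for i j N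
  proof -
    have "1 / real (Suc i) \<le> 1 / real (Suc N)" "1 / real (Suc j) \<le> 1 / real (Suc N)"
      using that by (simp_all add: frac_le)
    with u[of i] u[of j] have "Q (u i) < m + 1 / real (Suc N)" "Q (u j) < m + 1 / real (Suc N)"
      by linarith+
    with m[of "(1/2) *\<^sub>R (u i + u j)"]
    have "Q (u i) + Q (u j) - 2 * Q ((1/2) *\<^sub>R (u i + u j)) < 2 * (1 / real (Suc N))"
      by linarith
    then have "4 * (Q (u i) + Q (u j) - 2 * Q ((1/2) *\<^sub>R (u i + u j))) < 4 * (2 * (1 / real (Suc N)))"
      by (rule mult_strict_left_mono) simp
    then show ?thesis unfolding par by simp
  qed
  have "Cauchy u"
  proof (rule metric_CauchyI)
    fix e :: real assume "e > 0"
    then obtain N where N: "8 / e\<^sup>2 < real N" using reals_Archimedean2 by blast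
    have "8 / real (Suc N) \<le> e\<^sup>2"
    proof -
      have "8 < e\<^sup>2 * real N" using N \<open>e > 0\<close> by (simp add: field_simps)
      also have "\<dots> \<le> e\<^sup>2 * real (Suc N)" by (simp add: mult_left_mono)
      finally show ?thesis by (simp add: field_simps)
    qed
    then have "(norm (u i - u j))\<^sup>2 < e\<^sup>2" if "i \<ge> N" "j \<ge> N" for i j
      using close[OF that] by (rule less_le_trans[rotated])
    then have "dist (u i) (u j) < e" if "i \<ge> N" "j \<ge> N" for i j
      unfolding dist_norm using that \<open>e > 0\<close> by (metis less_imp_le power2_less_imp_less)
    then show "\<exists>M. \<forall>i\<ge>M. \<forall>j\<ge>M. dist (u i) (u j) < e" by blast
  qed
  then obtain z where z: "u \<longlonglongrightarrow> z" using Cauchy_convergent convergent_def by blast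
  have "(\<lambda>n. Q (u n)) \<longlonglongrightarrow> Q z"
    unfolding Q_def using z by (intro tendsto_intros g.tendsto) auto
  moreover have "(\<lambda>n. m + 1 / real (Suc n)) \<longlonglongrightarrow> m + 0"
    using LIMSEQ_inverse_real_of_nat by (intro tendsto_intros) (simp add: inverse_eq_divide)
  ultimately have "Q z \<le> m + 0"
    by (rule LIMSEQ_le) (use u less_imp_le in blast)
  then have min: "Q z \<le> Q x" for x using m[of x] by simp
  have "g x = inner x z" for x
  proof -
    define a where "a = inner x z - g x"
    have q: "0 \<le> t * a + t\<^sup>2 * inner x x / 2" for t
      using min[of "z + t *\<^sub>R x"] unfolding Q_def a_def
      by (simp add: g.scaleR g.add inner_add_left inner_add_right inner_commute
          power2_eq_square field_simps)
    have "a = 0"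
    proof (rule ccontr)
      assume "a \<noteq> 0"
      define s where "s = inner x x + 1"
      have s: "s > 0" "inner x x < 2 * s" by (simp_all add: s_def add_nonneg_pos add_strict_increasing2)
      have "0 \<le> (- a / s) * a + (- a / s)\<^sup>2 * inner x x / 2" by (rule q)
      also have "\<dots> < (- a / s) * a + (- a / s)\<^sup>2 * (2 * s) / 2"
        using s \<open>a \<noteq> 0\<close> by (simp add: divide_strict_right_mono)
      also have "\<dots> = 0" using s by (simp add: power2_eq_square)
      finally show False by simp
    qed
    then show ?thesis by (simp add: a_def)
  qed
  then show ?thesis by blast
qed

lemma inner_eqI:
  fixes z :: "'a::complex_inner"
  assumes "\<And>x. inner x z = inner x w"
  shows "z = w"
proof -
  have "inner (z - w) (z - w) = 0" using assms[of "z - w"] by (simp add: inner_diff_right)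
  then show ?thesis by simp
qed

lemma cadjoint_ex1:
  fixes A :: "'a::chilbert_space \<Rightarrow> 'a"
  assumes "bounded_clinear A"
  shows "\<exists>!A'. \<forall>x y. cinner (A x) y = cinner x (A' y)"
proof -
  have lin: "bounded_linear A" and sc: "\<And>c x. A (c *\<^sub>C x) = c *\<^sub>C A x"
    using assms by (auto simp: bounded_clinear_def)
  have "\<exists>z. \<forall>x. cinner (A x) y = cinner x z" for y
  proof -
    have "bounded_linear (\<lambda>x. inner (A x) y)"
      using bounded_linear_compose[OF bounded_linear_inner_left lin] .
    then obtain z where z: "\<And>x. inner (A x) y = inner x z" using riesz_real by blast
    have "cinner (A x) y = cinner x z" for x
    proof (rule complex_eqI)
      show "Re (cinner (A x) y) = Re (cinner x z)"
        using z[of x] by (simp add: inner_eq_Re_cinner)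
      show "Im (cinner (A x) y) = Im (cinner x z)"
        using z[of "\<i> *\<^sub>C x"] by (simp add: inner_eq_Re_cinner sc cinner_scaleC_left)
    qed
    then show ?thesis by blast
  qed
  then obtain A' where A': "\<forall>x y. cinner (A x) y = cinner x (A' y)" by metis
  show ?thesis
  proof (intro ex1I)
    show "\<forall>x y. cinner (A x) y = cinner x (A' y)" by (rule A')
  next
    fix C assume C: "\<forall>x y. cinner (A x) y = cinner x (C y)"
    show "C = A'"
    proof (intro ext inner_eqI)
      fix x y
      have "cinner x (C y) = cinner x (A' y)" using A' C by simp
      then show "inner x (C y) = inner x (A' y)" by (simp add: inner_eq_Re_cinner)
    qed
  qed
qed

lemma cinner_cadjoint:
  fixes A :: "'a::chilbert_space \<Rightarrow> 'a"
  assumes "bounded_clinear A"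
  shows "cinner (A x) y = cinner x (cadjoint A y)"
  using theI'[OF cadjoint_ex1[OF assms]] unfolding cadjoint_def by blast

end

theory Submission
  imports Defs
begin

text \<open>
  Put \<open>u = B x\<close>, \<open>z = A\<^sup>* y\<close> and \<open>M = \<parallel>X\<parallel>\<close>, and split \<open>\<langle>X u, z\<rangle> = \<langle>(X - \<lambda> M) u, z\<rangle> + \<lambda> M \<langle>u, z\<rangle>\<close>.
  It remains to see that \<open>\<parallel>X - \<lambda> M\<parallel> \<le> M max {|\<lambda>|, |1 - \<lambda>|}\<close>. Instead of the spectral theorem this
  uses \<open>X\<^sup>2 \<le> M X\<close>: expanding \<open>\<parallel>(X - \<lambda> M) u\<parallel>\<^sup>2\<close> then leaves a bound that is affine in
  \<open>\<langle>X u, u\<rangle> \<in> [0, M \<parallel>u\<parallel>\<^sup>2]\<close>, hence largest at an endpoint. The second bound is \<open>\<lambda> = 1/2\<close>.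
\<close>

text \<open>The class ties the norm to real scalars only; the complex case follows by pulling
  \<open>c\<close> out of both slots of \<open>cinner\<close>, the second time conjugated.\<close>

lemma norm_scaleC: "norm (c *\<^sub>C x) = cmod c * norm x"
  for x :: "'a::complex_inner"
proof -
  have "cinner (c *\<^sub>C x) (c *\<^sub>C x) = c * cnj (c * cinner x x)"
    by (metis cinner_commute cinner_scaleC_left)
  also have "\<dots> = complex_of_real ((cmod c * norm x)\<^sup>2)"
    by (simp add: cinner_self power_mult_distrib complex_norm_square mult.assoc del: of_real_power)
  finally have "(norm (c *\<^sub>C x))\<^sup>2 = (cmod c * norm x)\<^sup>2"
    unfolding cinner_self of_real_eq_iff .
  then show ?thesis by simp
qed

text \<open>A unimodular factor on \<open>x\<close> rotates \<open>cinner x y\<close> onto the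
  nonnegative real axis, where it agrees with \<open>inner\<close>; the real Cauchy-Schwarz
  inequality then applies.\<close>

lemma cmod_cinner_le: "cmod (cinner x y) \<le> norm x * norm y"
  for x y :: "'a::complex_inner"
proof (cases "cinner x y = 0")
  case False
  define c where "c = cnj (sgn (cinner x y))"
  have c: "cmod c = 1" using False by (simp add: c_def norm_sgn)
  have "c * cinner x y = complex_of_real (cmod (cinner x y))"
    using False
    by (simp add: c_def sgn_div_norm scaleR_conv_of_real complex_norm_square[symmetric]
        field_simps power2_eq_square)
  then have "cmod (cinner x y) = inner (c *\<^sub>C x) y"
    by (simp add: inner_eq_Re_cinner cinner_scaleC_left)
  also have "\<dots> \<le> norm (c *\<^sub>C x) * norm y" by (rule norm_cauchy_schwarz)
  finally show ?thesis by (simp add: norm_scaleC c)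
qed simp

context
  fixes X :: "'a::chilbert_space \<Rightarrow> 'a"
  assumes X: "bounded_clinear X" and pos: "positive_op X"
begin

lemma bounded_linear_positive_op: "bounded_linear X"
  using X by (simp add: bounded_clinear_def)

lemma positive_op_cinner: "cinner (X u) u = complex_of_real (inner (X u) u)"
  using pos by (auto simp: positive_op_def inner_eq_Re_cinner complex_nonneg_Reals_iff
      intro!: complex_eqI)

lemma positive_op_inner_nonneg: "inner (X u) u \<ge> 0"
  using pos by (auto simp: positive_op_def inner_eq_Re_cinner complex_nonneg_Reals_iff)

lemma positive_op_inner_sym: "inner (X u) v = inner u (X v)"
  using cinner_cadjoint[OF X, of u v] pos by (simp add: positive_op_def inner_eq_Re_cinner)

lemma positive_op_inner_le: "inner (X u) u \<le> onorm X * (norm u)\<^sup>2"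
proof -
  have "inner (X u) u \<le> norm (X u) * norm u" by (rule norm_cauchy_schwarz)
  also have "\<dots> \<le> onorm X * norm u * norm u"
    by (intro mult_right_mono onorm[OF bounded_linear_positive_op]) simp
  finally show ?thesis by (simp add: power2_eq_square mult.assoc)
qed

text \<open>Positivity of \<open>X\<close> at the vector \<open>M u - X u\<close>, with
  \<open>M = onorm X\<close>, gives the claim multiplied by \<open>M\<close>. The case
  \<open>M = 0\<close> is separate because \<open>M\<close> is cancelled at the end.\<close>

lemma positive_op_norm_square_le: "(norm (X u))\<^sup>2 \<le> onorm X * inner (X u) u"
proof (cases "onorm X = 0")
  case True
  then show ?thesis using onorm[OF bounded_linear_positive_op, of u] by simp
next
  case False
  define M where "M = onorm X"
  have M: "M > 0" using False onorm_pos_le[OF bounded_linear_positive_op] by (simp add: M_def)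
  interpret bounded_linear X by (rule bounded_linear_positive_op)
  have "0 \<le> inner (X (M *\<^sub>R u - X u)) (M *\<^sub>R u - X u)" by (rule positive_op_inner_nonneg)
  also have "\<dots> = M * (M * inner (X u) u) - 2 * M * (norm (X u))\<^sup>2 + inner (X (X u)) (X u)"
    using positive_op_inner_sym[of "X u" u]
    by (simp add: diff scaleR inner_diff_left inner_diff_right power2_norm_eq_inner algebra_simps)
  \<comment> \<open>This bound absorbs one of the two copies of
    \<open>M * (norm (X u))\<^sup>2\<close> that are subtracted above.\<close>
  also have "inner (X (X u)) (X u) \<le> M * (norm (X u))\<^sup>2"
    unfolding M_def by (rule positive_op_inner_le)
  finally have "M * (norm (X u))\<^sup>2 \<le> M * (M * inner (X u) u)" by simp
  then show ?thesis using M by (simp add: M_def)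
qed

lemma positive_op_norm_diff_le:
  "norm (X u - (l * complex_of_real (onorm X)) *\<^sub>C u)
    \<le> onorm X * max (cmod l) (cmod (1 - l)) * norm u"
proof -
  define M p m where "M = onorm X" and "p = inner (X u) u" and "m = max (cmod l) (cmod (1 - l))"
  define w where "w = (l * complex_of_real M) *\<^sub>C u"
  have M: "M \<ge> 0" unfolding M_def by (rule onorm_pos_le[OF bounded_linear_positive_op])
  have m: "m \<ge> 0" by (simp add: m_def le_max_iff_disj)
  have p: "0 \<le> p" "p \<le> M * (norm u)\<^sup>2"
    unfolding p_def M_def by (rule positive_op_inner_nonneg positive_op_inner_le)+
  \<comment> \<open>Since this number is real, only \<open>Re l\<close> survives in the cross term
    of the square.\<close>
  have "cinner u (X u) = complex_of_real p"
    using cinner_commute[of u "X u"] positive_op_cinner[of u] by (simp add: p_def)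
  then have "inner (X u) w = M * Re l * p"
    by (simp add: inner_commute[of "X u"] w_def inner_eq_Re_cinner[of _ "X u"] cinner_scaleC_left)
  then have "(norm (X u - w))\<^sup>2 = (norm (X u))\<^sup>2 - 2 * (M * Re l * p) + (norm w)\<^sup>2"
    by (simp add: power2_norm_eq_inner inner_diff_left inner_diff_right inner_commute)
  also have "(norm w)\<^sup>2 = (cmod l)\<^sup>2 * (M * norm u)\<^sup>2"
    using M by (simp add: w_def norm_scaleC norm_mult power_mult_distrib)
  also have "(norm (X u))\<^sup>2 \<le> M * p"
    unfolding M_def p_def by (rule positive_op_norm_square_le)
  finally have *: "(norm (X u - w))\<^sup>2 \<le> (1 - 2 * Re l) * (M * p) + (cmod l)\<^sup>2 * (M * norm u)\<^sup>2"
    by (simp add: algebra_simps)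
  have Mp: "0 \<le> M * p" "M * p \<le> (M * norm u)\<^sup>2"
    using mult_left_mono[OF p(2) M] M p(1) by (simp_all add: power2_eq_square mult_ac)
  have "cmod l \<le> m" "cmod (1 - l) \<le> m" by (simp_all add: m_def)
  then have sq: "(cmod l)\<^sup>2 \<le> m\<^sup>2" "(cmod (1 - l))\<^sup>2 \<le> m\<^sup>2" by (simp_all add: power_mono)
  \<comment> \<open>This is the coefficient that \<open>*\<close> yields at the right endpoint
    \<open>M * p = (M * norm u)\<^sup>2\<close>.\<close>
  have l: "(cmod (1 - l))\<^sup>2 = (1 - 2 * Re l) + (cmod l)\<^sup>2"
    by (simp add: cmod_power2 power2_diff)
  have "(norm (X u - w))\<^sup>2 \<le> m\<^sup>2 * (M * norm u)\<^sup>2"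
  \<comment> \<open>The sign of the slope \<open>1 - 2 * Re l\<close> decides the worst endpoint:
    the right one gives \<open>cmod (1 - l)\<close>, the left one, \<open>M * p = 0\<close>, gives
    \<open>cmod l\<close>.\<close>
  proof (cases "1 - 2 * Re l \<ge> 0")
    case True
    then have "(1 - 2 * Re l) * (M * p) \<le> (1 - 2 * Re l) * (M * norm u)\<^sup>2"
      by (intro mult_left_mono Mp)
    with * have "(norm (X u - w))\<^sup>2 \<le> (cmod (1 - l))\<^sup>2 * (M * norm u)\<^sup>2"
      unfolding l by (simp only: distrib_right)
    also have "\<dots> \<le> m\<^sup>2 * (M * norm u)\<^sup>2" by (intro mult_right_mono sq) simp
    finally show ?thesis .
  next
    case False
    then have "(1 - 2 * Re l) * (M * p) \<le> 0" using Mp(1) by (intro mult_nonpos_nonneg) auto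
    with * have "(norm (X u - w))\<^sup>2 \<le> (cmod l)\<^sup>2 * (M * norm u)\<^sup>2" by linarith
    also have "\<dots> \<le> m\<^sup>2 * (M * norm u)\<^sup>2" by (intro mult_right_mono sq) simp
    finally show ?thesis .
  qed
  then have "(norm (X u - w))\<^sup>2 \<le> (M * m * norm u)\<^sup>2"
    by (simp add: power_mult_distrib mult_ac)
  then have "norm (X u - w) \<le> M * m * norm u"
    by (rule power2_le_imp_le) (use M m in simp)
  then show ?thesis by (simp add: w_def M_def m_def)
qed

lemma positive_op_cinner_le:
  "cmod (cinner (X u) z)
    \<le> onorm X * (max (cmod l) (cmod (1 - l)) * norm u * norm z + cmod l * cmod (cinner u z))"
proof -
  define c where "c = l * complex_of_real (onorm X)"
  have c: "cmod c = onorm X * cmod l"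
    by (simp add: c_def norm_mult onorm_pos_le[OF bounded_linear_positive_op])
  have "cinner (X u) z = cinner (X u - c *\<^sub>C u) z + c * cinner u z"
    using cinner_add_left[of "X u - c *\<^sub>C u" "c *\<^sub>C u" z] by (simp add: cinner_scaleC_left)
  then have "cmod (cinner (X u) z) \<le> cmod (cinner (X u - c *\<^sub>C u) z) + cmod c * cmod (cinner u z)"
    by (metis norm_mult norm_triangle_ineq)
  also have "cmod (cinner (X u - c *\<^sub>C u) z) \<le> norm (X u - c *\<^sub>C u) * norm z"
    by (rule cmod_cinner_le)
  also have "\<dots> \<le> onorm X * max (cmod l) (cmod (1 - l)) * norm u * norm z"
    unfolding c_def by (intro mult_right_mono positive_op_norm_diff_le) simp
  finally show ?thesis by (simp add: c algebra_simps)
qed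

end

theorem theorem3:
  fixes A B X :: "'a::chilbert_space \<Rightarrow> 'a"
  assumes "bounded_clinear A" and "bounded_clinear B" and "bounded_clinear X"
    and "positive_op X"
  shows "(\<forall>(l::complex) x y. cmod (cinner (A (X (B x))) y)
            \<le> onorm X * (max (cmod l) (cmod (1 - l)) * norm (B x) * norm (cadjoint A y)
                          + cmod l * cmod (cinner (A (B x)) y)))
       \<and> (\<forall>x y. cmod (cinner (A (X (B x))) y)
            \<le> onorm X / 2 * (cmod (cinner (A (B x)) y) + norm (B x) * norm (cadjoint A y)))"
proof -
  have main: "cmod (cinner (A (X (B x))) y)
      \<le> onorm X * (max (cmod l) (cmod (1 - l)) * norm (B x) * norm (cadjoint A y)
                    + cmod l * cmod (cinner (A (B x)) y))" for l x y
    \<comment> \<open>Moving \<open>A\<close> to the second slot on both sides leaves an estimate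
      about \<open>X\<close> alone, at the vectors \<open>B x\<close> and
      \<open>cadjoint A y\<close>.\<close>
    unfolding cinner_cadjoint[OF assms(1)] by (rule positive_op_cinner_le[OF assms(3,4)])
  have "cmod (cinner (A (X (B x))) y)
      \<le> onorm X / 2 * (cmod (cinner (A (B x)) y) + norm (B x) * norm (cadjoint A y))" for x y
    \<comment> \<open>At \<open>1/2\<close> the maximum takes its least value and equals
      \<open>cmod l\<close>, so \<open>1/2\<close> factors out of both terms.\<close>
    using main[of x y "1/2"] by (simp add: algebra_simps)
  with main show ?thesis by blast
qed

end
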